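(* Let $\mathcal{A}$ be a preabelian category and $\mathcal{B}$ be an additive (full) subcategory of $\mathcal{A}$. Then: (1) $\mathcal{B}$ is coreflective if and only if it is precovering and closed under taking cokernels. (2) $\mathcal{B}$ is reflective if and only if it is preenveloping and closed under taking kernels.
   Context: A preabelian category is an additive category in which every morphism has a kernel and a cokernel. All subcategories are full and closed under isomorphisms; an additive subcategory contains the zero object and is closed under finite coproducts. $\mathcal{B}$ is coreflective (reflective) if the inclusion functor $\mathcal{B}\to\mathcal{A}$ has a right (left) adjoint. $\mathcal{B}$ is closed under cokernels (kernels) if the cokernel (kernel) in $\mathcal{A}$ of every morphism between objects of $\mathcal{B}$ belongs to $\mathcal{B}$. A $\mathcal{B}$-precover of $A$ is $f:B\to A$ with $B\in\mathcal{B}$ and $\mathcal{A}(B',f)$ surjective for all $B'\in\mathcal{B}$; $\mathcal{B}$ is precovering if every object of $\mathcal{A}$ has a $\mathcal{B}$-precover. $\mathcal{B}$-preenvelopes and preenveloping are dual. *)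

theory Defs
  imports "HOL-Algebra.Group"
begin

record ('o, 'm) category =
  Obj :: "'o set"
  Arr :: "'m set"
  Dom :: "'m \<Rightarrow> 'o"
  Cod :: "'m \<Rightarrow> 'o"
  Id :: "'o \<Rightarrow> 'm"
  Comp :: "'m \<Rightarrow> 'm \<Rightarrow> 'm" (infixl "\<cdot>\<index>" 70)  \<comment> \<open>\<open>g \<cdot> f\<close> is "first \<open>f\<close>, then \<open>g\<close>"\<close>

definition Hom :: "('o, 'm, 'x) category_scheme \<Rightarrow> 'o \<Rightarrow> 'o \<Rightarrow> 'm set" where
  "Hom C a b = {f \<in> Arr C. Dom C f = a \<and> Cod C f = b}"

locale category =
  fixes C :: "('o, 'm, 'x) category_scheme" (structure)
  assumes dom_in_Obj: "f \<in> Arr C \<Longrightarrow> Dom C f \<in> Obj C"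
    and cod_in_Obj: "f \<in> Arr C \<Longrightarrow> Cod C f \<in> Obj C"
    and id_in_Hom: "a \<in> Obj C \<Longrightarrow> Id C a \<in> Hom C a a"
    and comp_in_Hom: "\<lbrakk>g \<in> Hom C b c; f \<in> Hom C a b\<rbrakk> \<Longrightarrow> g \<cdot> f \<in> Hom C a c"
    and comp_id_right: "f \<in> Hom C a b \<Longrightarrow> f \<cdot> Id C a = f"
    and comp_id_left: "f \<in> Hom C a b \<Longrightarrow> Id C b \<cdot> f = f"
    and comp_assoc: "\<lbrakk>h \<in> Hom C c d; g \<in> Hom C b c; f \<in> Hom C a b\<rbrakk>
      \<Longrightarrow> (h \<cdot> g) \<cdot> f = h \<cdot> (g \<cdot> f)"

definition isomorphic_objs :: "('o, 'm, 'x) category_scheme \<Rightarrow> 'o \<Rightarrow> 'o \<Rightarrow> bool" where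
  "isomorphic_objs C a b \<longleftrightarrow> a \<in> Obj C \<and> b \<in> Obj C \<and>
    (\<exists>f \<in> Hom C a b. \<exists>g \<in> Hom C b a. g \<cdot>\<^bsub>C\<^esub> f = Id C a \<and> f \<cdot>\<^bsub>C\<^esub> g = Id C b)"

definition zero_object :: "('o, 'm, 'x) category_scheme \<Rightarrow> 'o \<Rightarrow> bool" where
  "zero_object C z \<longleftrightarrow> z \<in> Obj C \<and>
    (\<forall>a \<in> Obj C. (\<exists>!f. f \<in> Hom C z a) \<and> (\<exists>!f. f \<in> Hom C a z))"

text \<open>\<open>s\<close> with the injections \<open>\<iota> i\<close> is a coproduct of the family \<open>(x i)\<close>, \<open>i \<in> I\<close>.\<close>

definition is_coproduct ::
  "('o, 'm, 'x) category_scheme \<Rightarrow> 'i set \<Rightarrow> ('i \<Rightarrow> 'o) \<Rightarrow> 'o \<Rightarrow> ('i \<Rightarrow> 'm) \<Rightarrow> bool" where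
  "is_coproduct C I x s \<iota> \<longleftrightarrow> s \<in> Obj C \<and> (\<forall>i \<in> I. x i \<in> Obj C \<and> \<iota> i \<in> Hom C (x i) s) \<and>
    (\<forall>t \<in> Obj C. \<forall>f. (\<forall>i \<in> I. f i \<in> Hom C (x i) t) \<longrightarrow>
      (\<exists>!h. h \<in> Hom C s t \<and> (\<forall>i \<in> I. h \<cdot>\<^bsub>C\<^esub> \<iota> i = f i)))"


record ('o, 'm, 'p, 'n) cat_functor =
  ObjMap :: "'o \<Rightarrow> 'p"
  ArrMap :: "'m \<Rightarrow> 'n"

locale cat_functor = source: category C + target: category D
  for C :: "('o, 'm, 'x) category_scheme" and D :: "('p, 'n, 'y) category_scheme" +
  fixes F :: "('o, 'm, 'p, 'n) cat_functor"
  assumes map_Obj: "a \<in> Obj C \<Longrightarrow> ObjMap F a \<in> Obj D"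
    and map_Hom: "f \<in> Hom C a b \<Longrightarrow> ArrMap F f \<in> Hom D (ObjMap F a) (ObjMap F b)"
    and map_Id: "a \<in> Obj C \<Longrightarrow> ArrMap F (Id C a) = Id D (ObjMap F a)"
    and map_Comp: "\<lbrakk>g \<in> Hom C b c; f \<in> Hom C a b\<rbrakk>
      \<Longrightarrow> ArrMap F (g \<cdot>\<^bsub>C\<^esub> f) = ArrMap F g \<cdot>\<^bsub>D\<^esub> ArrMap F f"

text \<open>\<open>F : C \<rightarrow> D\<close> is left adjoint to \<open>G : D \<rightarrow> C\<close>: there are bijections
  \<open>D(F a, b) \<cong> C(a, G b)\<close>, natural in \<open>a\<close> and \<open>b\<close>.\<close>

definition adjoint_functors ::
  "('o, 'm, 'x) category_scheme \<Rightarrow> ('p, 'n, 'y) category_scheme \<Rightarrow>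
    ('o, 'm, 'p, 'n) cat_functor \<Rightarrow> ('p, 'n, 'o, 'm) cat_functor \<Rightarrow> bool" where
  "adjoint_functors C D F G \<longleftrightarrow> cat_functor C D F \<and> cat_functor D C G \<and>
    (\<exists>\<phi> :: 'o \<Rightarrow> 'p \<Rightarrow> 'n \<Rightarrow> 'm.
      (\<forall>a \<in> Obj C. \<forall>b \<in> Obj D.
        bij_betw (\<phi> a b) (Hom D (ObjMap F a) b) (Hom C a (ObjMap G b))) \<and>
      (\<forall>a \<in> Obj C. \<forall>a' \<in> Obj C. \<forall>b \<in> Obj D. \<forall>b' \<in> Obj D.
        \<forall>f \<in> Hom C a' a. \<forall>g \<in> Hom D b b'. \<forall>h \<in> Hom D (ObjMap F a) b.
          \<phi> a' b' (g \<cdot>\<^bsub>D\<^esub> h \<cdot>\<^bsub>D\<^esub> ArrMap F f) = ArrMap G g \<cdot>\<^bsub>C\<^esub> \<phi> a b h \<cdot>\<^bsub>C\<^esub> f))"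


record ('o, 'm) preadditive_category = "('o, 'm) category" +
  Plus :: "'m \<Rightarrow> 'm \<Rightarrow> 'm" (infixl "\<boxplus>\<index>" 65)
  Zero :: "'o \<Rightarrow> 'o \<Rightarrow> 'm"

definition Hom_group ::
  "('o, 'm, 'x) preadditive_category_scheme \<Rightarrow> 'o \<Rightarrow> 'o \<Rightarrow> 'm monoid" where
  "Hom_group C a b = \<lparr>carrier = Hom C a b, mult = Plus C, one = Zero C a b\<rparr>"

locale preadditive_category = category C
  for C :: "('o, 'm, 'x) preadditive_category_scheme" (structure) +
  assumes Hom_comm_group: "\<lbrakk>a \<in> Obj C; b \<in> Obj C\<rbrakk> \<Longrightarrow> comm_group (Hom_group C a b)"
    and comp_plus_right: "\<lbrakk>g \<in> Hom C b c; f \<in> Hom C a b; f' \<in> Hom C a b\<rbrakk>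
      \<Longrightarrow> g \<cdot> (f \<boxplus> f') = g \<cdot> f \<boxplus> g \<cdot> f'"
    and comp_plus_left: "\<lbrakk>g \<in> Hom C b c; g' \<in> Hom C b c; f \<in> Hom C a b\<rbrakk>
      \<Longrightarrow> (g \<boxplus> g') \<cdot> f = g \<cdot> f \<boxplus> g' \<cdot> f"

text \<open>In a preadditive category finite coproducts are automatically biproducts.\<close>

locale additive_category = preadditive_category +
  assumes ex_zero_object: "\<exists>z. zero_object C z"
    and ex_finite_coproduct: "(\<And>i. i < n \<Longrightarrow> x i \<in> Obj C) \<Longrightarrow> \<exists>s \<iota>. is_coproduct C {..<n::nat} x s \<iota>"

definition is_kernel :: "('o, 'm, 'x) preadditive_category_scheme \<Rightarrow> 'm \<Rightarrow> 'm \<Rightarrow> bool" where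
  "is_kernel C f k \<longleftrightarrow> f \<in> Arr C \<and> k \<in> Hom C (Dom C k) (Dom C f) \<and>
    f \<cdot>\<^bsub>C\<^esub> k = Zero C (Dom C k) (Cod C f) \<and>
    (\<forall>t \<in> Obj C. \<forall>g \<in> Hom C t (Dom C f). f \<cdot>\<^bsub>C\<^esub> g = Zero C t (Cod C f) \<longrightarrow>
      (\<exists>!u. u \<in> Hom C t (Dom C k) \<and> k \<cdot>\<^bsub>C\<^esub> u = g))"

definition is_cokernel :: "('o, 'm, 'x) preadditive_category_scheme \<Rightarrow> 'm \<Rightarrow> 'm \<Rightarrow> bool" where
  "is_cokernel C f c \<longleftrightarrow> f \<in> Arr C \<and> c \<in> Hom C (Cod C f) (Cod C c) \<and>
    c \<cdot>\<^bsub>C\<^esub> f = Zero C (Dom C f) (Cod C c) \<and>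
    (\<forall>t \<in> Obj C. \<forall>g \<in> Hom C (Cod C f) t. g \<cdot>\<^bsub>C\<^esub> f = Zero C (Dom C f) t \<longrightarrow>
      (\<exists>!u. u \<in> Hom C (Cod C c) t \<and> u \<cdot>\<^bsub>C\<^esub> c = g))"

locale preabelian_category = additive_category +
  assumes ex_kernel: "f \<in> Arr C \<Longrightarrow> \<exists>k. is_kernel C f k"
    and ex_cokernel: "f \<in> Arr C \<Longrightarrow> \<exists>c. is_cokernel C f c"


text \<open>All subcategories are full, so a subcategory is given by its set \<open>B\<close> of objects.\<close>

definition full_subcategory ::
  "('o, 'm, 'x) category_scheme \<Rightarrow> 'o set \<Rightarrow> ('o, 'm, 'x) category_scheme" where
  "full_subcategory C B = C\<lparr>Obj := B, Arr := {f \<in> Arr C. Dom C f \<in> B \<and> Cod C f \<in> B}\<rparr>"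

text \<open>The inclusion of a full subcategory; source and target are supplied where it is used.\<close>

definition inclusion_functor :: "('o, 'm, 'o, 'm) cat_functor" where
  "inclusion_functor = \<lparr>ObjMap = (\<lambda>a. a), ArrMap = (\<lambda>f. f)\<rparr>"

definition additive_subcategory ::
  "('o, 'm, 'x) preadditive_category_scheme \<Rightarrow> 'o set \<Rightarrow> bool" where
  "additive_subcategory A B \<longleftrightarrow> B \<subseteq> Obj A \<and>
    (\<forall>a b. a \<in> B \<longrightarrow> isomorphic_objs A a b \<longrightarrow> b \<in> B) \<and>
    (\<exists>z \<in> B. zero_object A z) \<and>
    (\<forall>(n::nat) x s \<iota>. (\<forall>i<n. x i \<in> B) \<longrightarrow> is_coproduct A {..<n} x s \<iota> \<longrightarrow> s \<in> B)"

definition coreflective :: "('o, 'm, 'x) category_scheme \<Rightarrow> 'o set \<Rightarrow> bool" where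
  "coreflective A B \<longleftrightarrow> (\<exists>R. adjoint_functors (full_subcategory A B) A inclusion_functor R)"

definition reflective :: "('o, 'm, 'x) category_scheme \<Rightarrow> 'o set \<Rightarrow> bool" where
  "reflective A B \<longleftrightarrow> (\<exists>L. adjoint_functors A (full_subcategory A B) L inclusion_functor)"

definition closed_under_kernels ::
  "('o, 'm, 'x) preadditive_category_scheme \<Rightarrow> 'o set \<Rightarrow> bool" where
  "closed_under_kernels A B \<longleftrightarrow>
    (\<forall>a \<in> B. \<forall>b \<in> B. \<forall>f \<in> Hom A a b. \<forall>k. is_kernel A f k \<longrightarrow> Dom A k \<in> B)"

definition closed_under_cokernels ::
  "('o, 'm, 'x) preadditive_category_scheme \<Rightarrow> 'o set \<Rightarrow> bool" where
  "closed_under_cokernels A B \<longleftrightarrow>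
    (\<forall>a \<in> B. \<forall>b \<in> B. \<forall>f \<in> Hom A a b. \<forall>c. is_cokernel A f c \<longrightarrow> Cod A c \<in> B)"

definition is_precover ::
  "('o, 'm, 'x) category_scheme \<Rightarrow> 'o set \<Rightarrow> 'o \<Rightarrow> 'o \<Rightarrow> 'm \<Rightarrow> bool" where
  "is_precover A B a b f \<longleftrightarrow> b \<in> B \<and> f \<in> Hom A b a \<and>
    (\<forall>b' \<in> B. (\<lambda>g. f \<cdot>\<^bsub>A\<^esub> g) ` Hom A b' b = Hom A b' a)"

definition is_preenvelope ::
  "('o, 'm, 'x) category_scheme \<Rightarrow> 'o set \<Rightarrow> 'o \<Rightarrow> 'o \<Rightarrow> 'm \<Rightarrow> bool" where
  "is_preenvelope A B a b f \<longleftrightarrow> b \<in> B \<and> f \<in> Hom A a b \<and>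
    (\<forall>b' \<in> B. (\<lambda>g. g \<cdot>\<^bsub>A\<^esub> f) ` Hom A b b' = Hom A a b')"

definition precovering :: "('o, 'm, 'x) category_scheme \<Rightarrow> 'o set \<Rightarrow> bool" where
  "precovering A B \<longleftrightarrow> (\<forall>a \<in> Obj A. \<exists>b f. is_precover A B a b f)"

definition preenveloping :: "('o, 'm, 'x) category_scheme \<Rightarrow> 'o set \<Rightarrow> bool" where
  "preenveloping A B \<longleftrightarrow> (\<forall>a \<in> Obj A. \<exists>b f. is_preenvelope A B a b f)"


lemma Hom_full_subcategory:
  "Hom (full_subcategory C B) a b = {f \<in> Hom C a b. a \<in> B \<and> b \<in> B}"
  by (auto simp: Hom_def full_subcategory_def)

lemma full_subcategory_simps [simp]:
  "Obj (full_subcategory C B) = B" "Id (full_subcategory C B) = Id C"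
  "Comp (full_subcategory C B) = Comp C"
  "Dom (full_subcategory C B) = Dom C" "Cod (full_subcategory C B) = Cod C"
  by (simp_all add: full_subcategory_def)

lemma (in category) category_full_subcategory:
  assumes "B \<subseteq> Obj C"
  shows "category (full_subcategory C B)"
proof
  fix f assume "f \<in> Arr (full_subcategory C B)"
  then show "Dom (full_subcategory C B) f \<in> Obj (full_subcategory C B)"
    and "Cod (full_subcategory C B) f \<in> Obj (full_subcategory C B)"
    by (auto simp: full_subcategory_def)
qed (use assms in \<open>auto simp: Hom_full_subcategory
      intro: id_in_Hom comp_in_Hom comp_id_right comp_id_left comp_assoc\<close>)

lemma (in category) inclusion_is_functor:
  assumes "B \<subseteq> Obj C"
  shows "cat_functor (full_subcategory C B) C inclusion_functor"
  unfolding cat_functor_def cat_functor_axioms_def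
  using assms category_full_subcategory category_axioms
  by (auto simp: Hom_full_subcategory inclusion_functor_def)

end

(* Let f : b -> a be a B-precover, k a kernel of f, p a B-precover of the domain of k, and c the
   cokernel of k p, so that f = f' c.  Then c identifies any two morphisms from an object of B that
   f identifies.  Lifting f' = f s along the precover gives f s c = f, hence c s c = c, hence c s = 1
   since c is epi.  So f' x = f' y forces x = c s x = c s y = y, and f' is a coreflection.
   Conversely, if e : r -> t is a coreflection of the target of a cokernel c : b -> t of a morphism
   in B, then c lifts to r and the lift factors through c, which yields an inverse of e.
   Only the self-dual structure (addition of morphisms, kernels and cokernels) enters, so the second
   claim is the first one in the opposite category. *)
theory Submission
  imports Defs
begin

section \<open>Coreflections as universal arrows\<close>

text \<open>A universal arrow from the inclusion of \<open>B\<close> to \<open>a\<close>. Unique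
  factorisation is put as bijectivity of composition with \<open>e\<close>, so that
  \<open>is_precover\<close> is exactly its surjective half.\<close>

definition is_coreflection ::
  "('o, 'm, 'x) category_scheme \<Rightarrow> 'o set \<Rightarrow> 'o \<Rightarrow> 'o \<Rightarrow> 'm \<Rightarrow> bool" where
  "is_coreflection A B a b e \<longleftrightarrow> b \<in> B \<and> e \<in> Hom A b a \<and>
    (\<forall>b' \<in> B. bij_betw (\<lambda>g. e \<cdot>\<^bsub>A\<^esub> g) (Hom A b' b) (Hom A b' a))"

lemma is_coreflection_imp_precover:
  assumes "is_coreflection A B a b e"
  shows "is_precover A B a b e"
  using assms by (simp add: is_precover_def is_coreflection_def bij_betw_def)

lemma adjoint_functorsE:
  assumes "adjoint_functors C D F G"
  obtains \<phi> where "cat_functor C D F" "cat_functor D C G"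
    "\<And>a b. a \<in> Obj C \<Longrightarrow> b \<in> Obj D \<Longrightarrow>
      bij_betw (\<phi> a b) (Hom D (ObjMap F a) b) (Hom C a (ObjMap G b))"
    "\<And>a a' b b' f g h. \<lbrakk>a \<in> Obj C; a' \<in> Obj C; b \<in> Obj D; b' \<in> Obj D;
        f \<in> Hom C a' a; g \<in> Hom D b b'; h \<in> Hom D (ObjMap F a) b\<rbrakk> \<Longrightarrow>
      \<phi> a' b' (g \<cdot>\<^bsub>D\<^esub> h \<cdot>\<^bsub>D\<^esub> ArrMap F f) = ArrMap G g \<cdot>\<^bsub>C\<^esub> \<phi> a b h \<cdot>\<^bsub>C\<^esub> f"
proof -
  obtain \<phi> where
    bij: "\<forall>a \<in> Obj C. \<forall>b \<in> Obj D.
      bij_betw (\<phi> a b) (Hom D (ObjMap F a) b) (Hom C a (ObjMap G b))" and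
    nat: "\<forall>a \<in> Obj C. \<forall>a' \<in> Obj C. \<forall>b \<in> Obj D. \<forall>b' \<in> Obj D.
      \<forall>f \<in> Hom C a' a. \<forall>g \<in> Hom D b b'. \<forall>h \<in> Hom D (ObjMap F a) b.
        \<phi> a' b' (g \<cdot>\<^bsub>D\<^esub> h \<cdot>\<^bsub>D\<^esub> ArrMap F f) = ArrMap G g \<cdot>\<^bsub>C\<^esub> \<phi> a b h \<cdot>\<^bsub>C\<^esub> f"
    using assms unfolding adjoint_functors_def by (elim conjE exE)
  show thesis
  proof (rule that[of \<phi>])
    show "cat_functor C D F" "cat_functor D C G"
      using assms by (simp_all add: adjoint_functors_def)
  qed (use bij nat in blast)+
qed

context category
begin

lemma Hom_ObjD:
  assumes "f \<in> Hom C a b"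
  shows "a \<in> Obj C" "b \<in> Obj C"
  using assms dom_in_Obj cod_in_Obj by (auto simp: Hom_def)

text \<open>The coreflection is the counit of the adjunction. Naturality makes the transposition
  \<phi> a left inverse of composition with the counit, and injectivity of \<phi> makes it a
  two-sided inverse.\<close>

lemma coreflective_imp_coreflection:
  assumes B: "B \<subseteq> Obj C" and cor: "coreflective C B" and a: "a \<in> Obj C"
  shows "\<exists>b e. is_coreflection C B a b e"
proof -
  obtain R where adj: "adjoint_functors (full_subcategory C B) C inclusion_functor R"
    using cor unfolding coreflective_def by blast
  obtain \<phi> where R: "cat_functor C (full_subcategory C B) R"
    and bij: "\<And>b a. \<lbrakk>b \<in> B; a \<in> Obj C\<rbrakk> \<Longrightarrow>
      bij_betw (\<phi> b a) (Hom C b a) (Hom (full_subcategory C B) b (ObjMap R a))"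
    and nat: "\<And>b b' a a' f g h. \<lbrakk>b \<in> B; b' \<in> B; a \<in> Obj C; a' \<in> Obj C;
        f \<in> Hom (full_subcategory C B) b' b; g \<in> Hom C a a'; h \<in> Hom C b a\<rbrakk> \<Longrightarrow>
      \<phi> b' a' (g \<cdot> h \<cdot> f) = ArrMap R g \<cdot> \<phi> b a h \<cdot> f"
    by (rule adjoint_functorsE[OF adj], simp add: inclusion_functor_def, blast)
  interpret R: cat_functor C "full_subcategory C B" R by (rule R)
  let ?r = "ObjMap R a"
  have r: "?r \<in> B" using R.map_Obj[OF a] by simp
  then have rO: "?r \<in> Obj C" using B by auto
  have Hom_sub: "Hom (full_subcategory C B) b ?r = Hom C b ?r" if "b \<in> B" for b
    using that r by (auto simp: Hom_full_subcategory)
  \<comment> \<open>The counit at \<open>a\<close> is the morphism whose transpose is the identity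
    of \<open>?r\<close>.\<close>
  obtain e where e: "e \<in> Hom C ?r a" and \<phi>e: "\<phi> ?r a e = Id C ?r"
    using bij[OF r a] Hom_sub[OF r] id_in_Hom[OF rO] unfolding bij_betw_def by (metis imageE)
  have "bij_betw (\<lambda>g. e \<cdot> g) (Hom C b ?r) (Hom C b a)" if b: "b \<in> B" for b
  proof -
    have lift: "\<phi> b a (e \<cdot> g) = g" if g: "g \<in> Hom C b ?r" for g
    proof -
      have "\<phi> b a (e \<cdot> g) = \<phi> b a (Id C a \<cdot> e \<cdot> g)"
        using comp_id_left[OF e] by simp
      also have "\<dots> = ArrMap R (Id C a) \<cdot> \<phi> ?r a e \<cdot> g"
        by (rule nat[OF r b a a _ id_in_Hom[OF a] e]) (use g Hom_sub[OF b] in simp)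
      also have "\<dots> = g"
        using R.map_Id[OF a] \<phi>e comp_id_left[OF id_in_Hom[OF rO]] comp_id_left[OF g] by simp
      finally show ?thesis .
    qed
    have inj: "inj_on (\<phi> b a) (Hom C b a)"
      and img: "\<phi> b a ` Hom C b a = Hom C b ?r"
      using bij[OF b a] Hom_sub[OF b] unfolding bij_betw_def by auto
    show ?thesis
    proof (rule bij_betw_byWitness[where f' = "\<phi> b a"])
      show "\<forall>g\<in>Hom C b ?r. \<phi> b a (e \<cdot> g) = g"
        using lift by blast
      show "\<forall>h\<in>Hom C b a. e \<cdot> \<phi> b a h = h"
      proof
        fix h assume h: "h \<in> Hom C b a"
        then have \<phi>h: "\<phi> b a h \<in> Hom C b ?r" using img by auto
        \<comment> \<open>Both sides have the same image under \<open>\<phi> b a\<close>: this is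
          \<open>lift\<close> applied to \<open>\<phi> b a h\<close>.\<close>
        show "e \<cdot> \<phi> b a h = h"
          by (rule inj_onD[OF inj lift[OF \<phi>h] comp_in_Hom[OF e \<phi>h] h])
      qed
    qed (use img comp_in_Hom[OF e] in auto)
  qed
  then show ?thesis
    using r e unfolding is_coreflection_def by blast
qed

text \<open>Chosen coreflections \<open>e a : r a \<rightarrow> a\<close> assemble into a right
  adjoint of the inclusion. It sends \<open>f : a \<rightarrow> b\<close> to the unique lift of
  \<open>f \<cdot> e a\<close> along \<open>e b\<close>, and uniqueness of lifts gives functoriality
  and naturality.\<close>

lemma coreflection_imp_coreflective:
  assumes B: "B \<subseteq> Obj C" and ex: "\<And>a. a \<in> Obj C \<Longrightarrow> \<exists>b e. is_coreflection C B a b e"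
  shows "coreflective C B"
proof -
  obtain r e where cor: "\<And>a. a \<in> Obj C \<Longrightarrow> is_coreflection C B a (r a) (e a)"
    using ex by metis
  have r: "r a \<in> B" and e: "e a \<in> Hom C (r a) a"
    and bij: "\<And>b. b \<in> B \<Longrightarrow> bij_betw (\<lambda>g. e a \<cdot> g) (Hom C b (r a)) (Hom C b a)"
    if "a \<in> Obj C" for a
    using cor[OF that] unfolding is_coreflection_def by auto
  \<comment> \<open>The inverse of composition with \<open>e a\<close>; it becomes the bijection of
    the adjunction.\<close>
  define lift where "lift = (\<lambda>b a. the_inv_into (Hom C b (r a)) (\<lambda>g. e a \<cdot> g))"
  have lift_bij: "bij_betw (lift b a) (Hom C b a) (Hom C b (r a))"
    if "b \<in> B" "a \<in> Obj C" for a b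
    unfolding lift_def by (rule bij_betw_the_inv_into[OF bij[OF that(2,1)]])
  have lift_in: "lift b a h \<in> Hom C b (r a)" if "b \<in> B" "h \<in> Hom C b a" for a b h
    using lift_bij[OF that(1)] Hom_ObjD(2)[OF that(2)] that(2) by (auto simp: bij_betw_def)
  have e_lift: "e a \<cdot> lift b a h = h" if "b \<in> B" "h \<in> Hom C b a" for a b h
    unfolding lift_def using f_the_inv_into_f_bij_betw[OF bij] that Hom_ObjD(2)[OF that(2)]
    by blast
  have lift_eqI: "lift b a h = g" if "b \<in> B" "g \<in> Hom C b (r a)" "a \<in> Obj C" "e a \<cdot> g = h"
    for a b g h
    unfolding lift_def
    using the_inv_into_f_f[of "\<lambda>g. e a \<cdot> g" "Hom C b (r a)" g] bij[OF that(3,1)] that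
    by (auto simp: bij_betw_def)
  \<comment> \<open>An arrow map receives only the morphism, so its source and target are recovered
    by \<open>Dom\<close> and \<open>Cod\<close>.\<close>
  define R where "R = \<lparr>ObjMap = r, ArrMap = (\<lambda>f. lift (r (Dom C f)) (Cod C f) (f \<cdot> e (Dom C f)))\<rparr>"
  have R_Obj: "ObjMap R = r" by (simp add: R_def)
  have R_Arr: "ArrMap R f = lift (r a) b (f \<cdot> e a)" if "f \<in> Hom C a b" for f a b
    using that by (simp add: R_def Hom_def)
  have R_in: "ArrMap R f \<in> Hom C (r a) (r b)"
    and e_R: "e b \<cdot> ArrMap R f = f \<cdot> e a" if f: "f \<in> Hom C a b" for f a b
    using lift_in e_lift r e comp_in_Hom[OF f] Hom_ObjD(1)[OF f] R_Arr[OF f] by auto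
  \<comment> \<open>The commuting square with the coreflections determines
    \<open>ArrMap R f\<close>; the identity and composition laws below are instances of
    this.\<close>
  have R_eqI: "ArrMap R f = g"
    if f: "f \<in> Hom C a b" and "g \<in> Hom C (r a) (r b)" "e b \<cdot> g = f \<cdot> e a" for f g a b
    using lift_eqI that r Hom_ObjD[OF f] R_Arr[OF f] by auto
  have fun_R: "cat_functor C (full_subcategory C B) R"
  proof (intro cat_functor.intro category_full_subcategory[OF B] category_axioms
      cat_functor_axioms.intro)
    fix a assume a: "a \<in> Obj C"
    show "ObjMap R a \<in> Obj (full_subcategory C B)" using r[OF a] by (simp add: R_Obj)
    have rO: "r a \<in> Obj C" using r[OF a] B by auto
    show "ArrMap R (Id C a) = Id (full_subcategory C B) (ObjMap R a)"
      using R_eqI[OF id_in_Hom[OF a] id_in_Hom[OF rO]] comp_id_right[OF e[OF a]]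
        comp_id_left[OF e[OF a]] by (simp add: R_Obj)
  next
    fix f a b assume f: "f \<in> Hom C a b"
    show "ArrMap R f \<in> Hom (full_subcategory C B) (ObjMap R a) (ObjMap R b)"
      using R_in[OF f] r Hom_ObjD[OF f] by (simp add: R_Obj Hom_full_subcategory)
  next
    fix f g a b c assume g: "g \<in> Hom C b c" and f: "f \<in> Hom C a b"
    have "e c \<cdot> (ArrMap R g \<cdot> ArrMap R f) = (e c \<cdot> ArrMap R g) \<cdot> ArrMap R f"
      using comp_assoc[OF e R_in[OF g] R_in[OF f]] Hom_ObjD[OF g] by simp
    also have "\<dots> = g \<cdot> (e b \<cdot> ArrMap R f)"
      using comp_assoc[OF g e R_in[OF f]] Hom_ObjD[OF g] e_R[OF g] by simp
    also have "\<dots> = g \<cdot> f \<cdot> e a"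
      using comp_assoc[OF g f e] Hom_ObjD[OF f] e_R[OF f] by simp
    finally show "ArrMap R (g \<cdot> f) = ArrMap R g \<cdot>\<^bsub>full_subcategory C B\<^esub> ArrMap R f"
      using R_eqI[OF comp_in_Hom[OF g f] comp_in_Hom[OF R_in[OF g] R_in[OF f]]] by simp
  qed
  \<comment> \<open>A lift is determined by its composite with \<open>e a'\<close>, so naturality is
    checked after composing with \<open>e a'\<close>.\<close>
  have natural: "lift b' a' (g \<cdot> h \<cdot> f) = ArrMap R g \<cdot> lift b a h \<cdot> f"
    if b: "b \<in> B" "b' \<in> B" and f: "f \<in> Hom C b' b" and g: "g \<in> Hom C a a'"
      and h: "h \<in> Hom C b a" for a a' b b' f g h
  proof (rule lift_eqI[OF b(2)])
    note l = lift_in[OF b(1) h]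
    note a = Hom_ObjD[OF g]
    show "ArrMap R g \<cdot> lift b a h \<cdot> f \<in> Hom C b' (r a')"
      by (intro comp_in_Hom[OF _ f] comp_in_Hom[OF _ l] R_in[OF g])
    have "e a' \<cdot> (ArrMap R g \<cdot> lift b a h \<cdot> f) = (e a' \<cdot> ArrMap R g) \<cdot> lift b a h \<cdot> f"
      using comp_assoc[OF e[OF a(2)] R_in[OF g] l]
        comp_assoc[OF e[OF a(2)] comp_in_Hom[OF R_in[OF g] l] f] by simp
    also have "\<dots> = g \<cdot> h \<cdot> f"
      using comp_assoc[OF g e[OF a(1)] l] e_R[OF g] e_lift[OF b(1) h] by simp
    finally show "e a' \<cdot> (ArrMap R g \<cdot> lift b a h \<cdot> f) = g \<cdot> h \<cdot> f" .
    show "a' \<in> Obj C" by (rule a)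
  qed
  have "adjoint_functors (full_subcategory C B) C inclusion_functor R"
    unfolding adjoint_functors_def
  proof (intro conjI inclusion_is_functor[OF B] fun_R exI[of _ lift] ballI)
    fix b a assume "b \<in> Obj (full_subcategory C B)" "a \<in> Obj C"
    then show "bij_betw (lift b a) (Hom C (ObjMap inclusion_functor b) a)
        (Hom (full_subcategory C B) b (ObjMap R a))"
      using lift_bij r by (simp add: inclusion_functor_def R_Obj Hom_full_subcategory)
  qed (use natural in \<open>auto simp: inclusion_functor_def Hom_full_subcategory\<close>)
  then show ?thesis unfolding coreflective_def by blast
qed

lemma coreflective_iff_coreflection:
  assumes "B \<subseteq> Obj C"
  shows "coreflective C B \<longleftrightarrow> (\<forall>a \<in> Obj C. \<exists>b e. is_coreflection C B a b e)"
  using coreflective_imp_coreflection[OF assms] coreflection_imp_coreflective[OF assms] by blast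

end

section \<open>Coreflective subcategories of preadditive categories\<close>

context preadditive_category
begin

section \<open>Zero morphisms and differences in the groups of morphisms\<close>

lemma Zero_in_Hom:
  assumes "a \<in> Obj C" "b \<in> Obj C"
  shows "Zero C a b \<in> Hom C a b"
proof -
  interpret G: comm_group "Hom_group C a b" by (rule Hom_comm_group[OF assms])
  show ?thesis using G.one_closed by (simp add: Hom_group_def)
qed

lemma plus_Zero:
  assumes "f \<in> Hom C a b"
  shows "f \<boxplus> Zero C a b = f"
proof -
  interpret G: comm_group "Hom_group C a b" using Hom_comm_group Hom_ObjD[OF assms] by blast
  show ?thesis using G.r_one[of f] assms by (simp add: Hom_group_def)
qed

lemma plus_eq_self_imp_Zero:
  assumes "f \<in> Hom C a b" "d \<in> Hom C a b" "f \<boxplus> d = f"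
  shows "d = Zero C a b"
proof -
  interpret G: comm_group "Hom_group C a b" using Hom_comm_group Hom_ObjD[OF assms(1)] by blast
  show ?thesis using G.l_cancel_one[of f d] assms by (simp add: Hom_group_def)
qed

text \<open>The witness is \<open>-g + f\<close> in the group of morphisms. Writing \<open>f\<close>
  as a sum avoids a subtraction, and \<open>comp_plus_right\<close> then applies directly.\<close>

lemma ex_difference:
  assumes "f \<in> Hom C a b" "g \<in> Hom C a b"
  shows "\<exists>d \<in> Hom C a b. f = g \<boxplus> d"
proof -
  interpret G: comm_group "Hom_group C a b" using Hom_comm_group Hom_ObjD[OF assms(1)] by blast
  have "f \<in> carrier (Hom_group C a b)" "g \<in> carrier (Hom_group C a b)"
    using assms by (simp_all add: Hom_group_def)
  then have "\<exists>d \<in> carrier (Hom_group C a b). f = g \<otimes>\<^bsub>Hom_group C a b\<^esub> d"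
    by (intro bexI[of _ "inv\<^bsub>Hom_group C a b\<^esub> g \<otimes>\<^bsub>Hom_group C a b\<^esub> f"])
      (simp_all add: G.m_assoc[symmetric])
  then show ?thesis by (simp add: Hom_group_def)
qed

text \<open>Additivity of composition gives \<open>z + z = z\<close> for the composite
  \<open>z\<close>, and cancellation in the group of morphisms forces \<open>z\<close> to be
  zero.\<close>

lemma comp_Zero:
  assumes g: "g \<in> Hom C b c" and a: "a \<in> Obj C"
  shows "g \<cdot> Zero C a b = Zero C a c"
proof -
  have z: "Zero C a b \<in> Hom C a b" using Zero_in_Hom a Hom_ObjD[OF g] by blast
  then have "g \<cdot> Zero C a b \<boxplus> g \<cdot> Zero C a b = g \<cdot> Zero C a b"
    using comp_plus_right[OF g z z] plus_Zero[OF z] by simp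
  then show ?thesis using plus_eq_self_imp_Zero comp_in_Hom[OF g z] by blast
qed

lemma Zero_comp:
  assumes f: "f \<in> Hom C a b" and c: "c \<in> Obj C"
  shows "Zero C b c \<cdot> f = Zero C a c"
proof -
  have z: "Zero C b c \<in> Hom C b c" using Zero_in_Hom c Hom_ObjD[OF f] by blast
  then have "Zero C b c \<cdot> f \<boxplus> Zero C b c \<cdot> f = Zero C b c \<cdot> f"
    using comp_plus_left[OF z z f] plus_Zero[OF z] by simp
  then show ?thesis using plus_eq_self_imp_Zero comp_in_Hom[OF z f] by blast
qed

section \<open>Universal properties of kernels, cokernels and precovers as rules with explicit
  objects\<close>

lemma kernelD:
  assumes "is_kernel C f k" "f \<in> Hom C a b"
  shows "k \<in> Hom C (Dom C k) a" "f \<cdot> k = Zero C (Dom C k) b"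
    "\<And>t g. g \<in> Hom C t a \<Longrightarrow> f \<cdot> g = Zero C t b \<Longrightarrow> \<exists>u \<in> Hom C t (Dom C k). k \<cdot> u = g"
proof -
  have f: "Dom C f = a" "Cod C f = b" using assms(2) by (auto simp: Hom_def)
  show "k \<in> Hom C (Dom C k) a" "f \<cdot> k = Zero C (Dom C k) b"
    using assms(1) unfolding is_kernel_def f by blast+
  show "\<exists>u \<in> Hom C t (Dom C k). k \<cdot> u = g"
    if g: "g \<in> Hom C t a" and fg: "f \<cdot> g = Zero C t b" for t g
    using assms(1) g fg Hom_ObjD(1)[OF g] unfolding is_kernel_def f by blast
qed

text \<open>The last fact says that a cokernel is an epimorphism. Any composite
  \<open>u \<cdot> c\<close> kills \<open>f\<close>, so the uniqueness clause of the universal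
  property applies to it and compares \<open>u\<close> with \<open>v\<close>.\<close>

lemma cokernelD:
  assumes "is_cokernel C f c" "f \<in> Hom C a b"
  shows "c \<in> Hom C b (Cod C c)" "c \<cdot> f = Zero C a (Cod C c)"
    "\<And>t g. g \<in> Hom C b t \<Longrightarrow> g \<cdot> f = Zero C a t \<Longrightarrow> \<exists>u \<in> Hom C (Cod C c) t. u \<cdot> c = g"
    "\<And>t u v. u \<in> Hom C (Cod C c) t \<Longrightarrow> v \<in> Hom C (Cod C c) t \<Longrightarrow> u \<cdot> c = v \<cdot> c \<Longrightarrow> u = v"
proof -
  have f: "Dom C f = a" "Cod C f = b" using assms(2) by (auto simp: Hom_def)
  show c: "c \<in> Hom C b (Cod C c)" and cf: "c \<cdot> f = Zero C a (Cod C c)"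
    using assms(1) unfolding is_cokernel_def f by blast+
  have univ: "\<exists>!u. u \<in> Hom C (Cod C c) t \<and> u \<cdot> c = g"
    if g: "g \<in> Hom C b t" and gf: "g \<cdot> f = Zero C a t" for t g
    using assms(1) g gf Hom_ObjD(2)[OF g] unfolding is_cokernel_def f by blast
  show "\<exists>u \<in> Hom C (Cod C c) t. u \<cdot> c = g"
    if "g \<in> Hom C b t" "g \<cdot> f = Zero C a t" for t g
    using univ[OF that] by blast
  show "u = v" if u: "u \<in> Hom C (Cod C c) t" and v: "v \<in> Hom C (Cod C c) t"
    and eq: "u \<cdot> c = v \<cdot> c" for t u v
  proof -
    have "u \<cdot> c \<cdot> f = Zero C a t"
      using comp_assoc[OF u c assms(2)] cf comp_Zero[OF u] Hom_ObjD(1)[OF assms(2)] by simp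
    from univ[OF comp_in_Hom[OF u c] this] show ?thesis
      using u v eq by auto
  qed
qed

lemma precoverE:
  assumes "precovering C B" "a \<in> Obj C"
  obtains b f where "b \<in> B" "f \<in> Hom C b a"
    "\<And>b' g. b' \<in> B \<Longrightarrow> g \<in> Hom C b' a \<Longrightarrow> \<exists>h \<in> Hom C b' b. f \<cdot> h = g"
proof -
  obtain b f where bf: "is_precover C B a b f"
    using assms unfolding precovering_def by blast
  show thesis
  proof (rule that[of b f])
    fix b' g assume "b' \<in> B" "g \<in> Hom C b' a"
    then have "g \<in> (\<lambda>h. f \<cdot> h) ` Hom C b' b"
      using bf unfolding is_precover_def by simp
    then show "\<exists>h \<in> Hom C b' b. f \<cdot> h = g" by blast
  qed (use bf in \<open>simp_all add: is_precover_def\<close>)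
qed

section \<open>Passing between coreflections on one side, precovers and closure under cokernels on
  the other\<close>

lemma coreflection_of_precover:
  assumes B: "B \<subseteq> Obj C" and pre: "precovering C B" and clo: "closed_under_cokernels C B"
    and ker: "\<And>f. f \<in> Arr C \<Longrightarrow> \<exists>k. is_kernel C f k"
    and coker: "\<And>f. f \<in> Arr C \<Longrightarrow> \<exists>c. is_cokernel C f c"
    and a: "a \<in> Obj C"
  shows "\<exists>b e. is_coreflection C B a b e"
proof -
  obtain b f where b: "b \<in> B" and f: "f \<in> Hom C b a"
    and f_lift: "\<And>b' g. b' \<in> B \<Longrightarrow> g \<in> Hom C b' a \<Longrightarrow> \<exists>h \<in> Hom C b' b. f \<cdot> h = g"
    by (rule precoverE[OF pre a]) blast
  obtain k where ker_k: "is_kernel C f k" using ker f by (auto simp: Hom_def)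
  define n where "n = Dom C k"
  note k = kernelD(1)[OF ker_k f, folded n_def] and fk = kernelD(2)[OF ker_k f, folded n_def]
    and k_lift = kernelD(3)[OF ker_k f, folded n_def]
  \<comment> \<open>The kernel object \<open>n\<close> may lie outside \<open>B\<close>. Covering it
    by \<open>q\<close> makes \<open>k \<cdot> p\<close> a morphism between objects of
    \<open>B\<close>, so that closure under cokernels puts \<open>r\<close> into
    \<open>B\<close>.\<close>
  obtain q p where q: "q \<in> B" and p: "p \<in> Hom C q n"
    and p_lift: "\<And>b' g. b' \<in> B \<Longrightarrow> g \<in> Hom C b' n \<Longrightarrow> \<exists>h \<in> Hom C b' q. p \<cdot> h = g"
    by (rule precoverE[OF pre Hom_ObjD(1)[OF k]]) blast
  have kp: "k \<cdot> p \<in> Hom C q b" by (rule comp_in_Hom[OF k p])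
  obtain c where coker_c: "is_cokernel C (k \<cdot> p) c" using coker kp by (auto simp: Hom_def)
  define r where "r = Cod C c"
  note c = cokernelD(1)[OF coker_c kp, folded r_def]
    and ckp = cokernelD(2)[OF coker_c kp, folded r_def]
    and c_factor = cokernelD(3)[OF coker_c kp, folded r_def]
    and c_epi = cokernelD(4)[OF coker_c kp, folded r_def]
  have r: "r \<in> B"
    using clo q b kp coker_c unfolding closed_under_cokernels_def r_def by blast
  have "f \<cdot> (k \<cdot> p) = Zero C q a"
    using comp_assoc[OF f k p] fk Zero_comp[OF p a] by simp
  then obtain f' where f': "f' \<in> Hom C r a" and f'c: "f' \<cdot> c = f"
    using c_factor[OF f] by blast
  obtain s where s: "s \<in> Hom C r b" and fs: "f \<cdot> s = f'"
    using f_lift[OF r f'] by blast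
  \<comment> \<open>The difference of \<open>x\<close> and \<open>y\<close> is killed by
    \<open>f\<close>, hence factors through \<open>k\<close>, and further through \<open>p\<close>
    because its source is in \<open>B\<close>. Since \<open>c\<close> kills
    \<open>k \<cdot> p\<close>, it kills the difference.\<close>
  have identify: "c \<cdot> x = c \<cdot> y"
    if b': "b' \<in> B" and x: "x \<in> Hom C b' b" and y: "y \<in> Hom C b' b" and eq: "f \<cdot> x = f \<cdot> y"
    for b' x y
  proof -
    obtain d where d: "d \<in> Hom C b' b" and xyd: "x = y \<boxplus> d"
      using ex_difference[OF x y] by blast
    have "f \<cdot> d = Zero C b' a"
      using plus_eq_self_imp_Zero[OF comp_in_Hom[OF f y] comp_in_Hom[OF f d]]
        comp_plus_right[OF f y d] eq xyd by simp
    then obtain u where u: "u \<in> Hom C b' n" "k \<cdot> u = d" using k_lift[OF d] by blast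
    then obtain v where v: "v \<in> Hom C b' q" and pv: "p \<cdot> v = u" using p_lift[OF b'] by blast
    have "c \<cdot> d = c \<cdot> (k \<cdot> p) \<cdot> v"
      using comp_assoc[OF c kp v] comp_assoc[OF k p v] u pv by simp
    then have "c \<cdot> d = Zero C b' r"
      using ckp Zero_comp[OF v] Hom_ObjD(2)[OF c] by simp
    then show ?thesis
      using comp_plus_right[OF c y d] xyd plus_Zero[OF comp_in_Hom[OF c y]] by simp
  qed
  have idr: "Id C r \<in> Hom C r r" and idb: "Id C b \<in> Hom C b b"
    using id_in_Hom r b B by auto
  \<comment> \<open>Here \<open>f \<cdot> (s \<cdot> c) = f' \<cdot> c = f = f \<cdot> Id C
    b\<close>, so \<open>identify\<close> applies to \<open>s \<cdot> c\<close> and the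
    identity.\<close>
  have "c \<cdot> (s \<cdot> c) = c \<cdot> Id C b"
    by (rule identify[OF b comp_in_Hom[OF s c] idb])
      (use comp_assoc[OF f s c] fs f'c comp_id_right[OF f] in simp)
  then have "c \<cdot> s \<cdot> c = Id C r \<cdot> c"
    using comp_assoc[OF c s c] comp_id_right[OF c] comp_id_left[OF c] by simp
  then have cs: "c \<cdot> s = Id C r"
    using c_epi[OF comp_in_Hom[OF c s] idr] by blast
  have "bij_betw (\<lambda>g. f' \<cdot> g) (Hom C b' r) (Hom C b' a)" if b': "b' \<in> B" for b'
    unfolding bij_betw_def
  proof
    show "inj_on (\<lambda>g. f' \<cdot> g) (Hom C b' r)"
    proof (rule inj_onI)
      fix x y assume x: "x \<in> Hom C b' r" and y: "y \<in> Hom C b' r" and eq: "f' \<cdot> x = f' \<cdot> y"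
      \<comment> \<open>As \<open>f \<cdot> s = f'\<close>, the assumed equality says that
        \<open>f\<close> identifies \<open>s \<cdot> x\<close> and
        \<open>s \<cdot> y\<close>.\<close>
      have "c \<cdot> (s \<cdot> x) = c \<cdot> (s \<cdot> y)"
        by (rule identify[OF b' comp_in_Hom[OF s x] comp_in_Hom[OF s y]])
          (use comp_assoc[OF f s x] comp_assoc[OF f s y] fs eq in simp)
      then show "x = y"
        using comp_assoc[OF c s x] comp_assoc[OF c s y] cs comp_id_left[OF x] comp_id_left[OF y]
        by simp
    qed
    show "(\<lambda>g. f' \<cdot> g) ` Hom C b' r = Hom C b' a"
    proof
      show "Hom C b' a \<subseteq> (\<lambda>g. f' \<cdot> g) ` Hom C b' r"
      proof
        fix g assume "g \<in> Hom C b' a"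
        \<comment> \<open>A lift along the precover \<open>f\<close> becomes a lift along
          \<open>f'\<close> after composing with \<open>c\<close>, because
          \<open>f' \<cdot> c = f\<close>.\<close>
        then obtain h where h: "h \<in> Hom C b' b" "f \<cdot> h = g" using f_lift[OF b'] by blast
        then have "g = f' \<cdot> (c \<cdot> h)" using comp_assoc[OF f' c] f'c by simp
        then show "g \<in> (\<lambda>g. f' \<cdot> g) ` Hom C b' r" using comp_in_Hom[OF c h(1)] by blast
      qed
    qed (use comp_in_Hom[OF f'] in auto)
  qed
  then show ?thesis using r f' unfolding is_coreflection_def by blast
qed

lemma closed_under_cokernels_if_coreflections:
  assumes B: "B \<subseteq> Obj C"
    and iso: "\<And>a b. a \<in> B \<Longrightarrow> isomorphic_objs C a b \<Longrightarrow> b \<in> B"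
    and ex: "\<And>a. a \<in> Obj C \<Longrightarrow> \<exists>b e. is_coreflection C B a b e"
  shows "closed_under_cokernels C B"
  unfolding closed_under_cokernels_def
proof (intro ballI allI impI)
  fix a b f c
  assume a: "a \<in> B" and b: "b \<in> B" and f: "f \<in> Hom C a b" and coker: "is_cokernel C f c"
  define t where "t = Cod C c"
  note c = cokernelD(1)[OF coker f, folded t_def]
    and cf = cokernelD(2)[OF coker f, folded t_def]
    and c_factor = cokernelD(3)[OF coker f, folded t_def]
    and c_epi = cokernelD(4)[OF coker f, folded t_def]
  have aO: "a \<in> Obj C" and tO: "t \<in> Obj C" using Hom_ObjD f c by blast+
  obtain r e where r: "r \<in> B" and e: "e \<in> Hom C r t"
    and bij: "\<And>b'. b' \<in> B \<Longrightarrow> bij_betw (\<lambda>g. e \<cdot> g) (Hom C b' r) (Hom C b' t)"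
    using ex[OF tO] unfolding is_coreflection_def by blast
  have rO: "r \<in> Obj C" using r B by auto
  \<comment> \<open>Left cancellation of \<open>e\<close> is available for morphisms out of objects
    of \<open>B\<close>. It is applied below with source \<open>a\<close> and with source
    \<open>r\<close>, both in \<open>B\<close>.\<close>
  have e_mono: "x = y"
    if "b' \<in> B" "x \<in> Hom C b' r" "y \<in> Hom C b' r" "e \<cdot> x = e \<cdot> y" for b' x y
    using bij[OF that(1)] that by (auto simp: bij_betw_def dest: inj_onD)
  obtain c' where c': "c' \<in> Hom C b r" and ec': "e \<cdot> c' = c"
    using bij[OF b] c unfolding bij_betw_def by (metis imageE)
  \<comment> \<open>The lift \<open>c'\<close> of \<open>c\<close> must kill \<open>f\<close> in
    order to factor through the cokernel; this is checked after composing with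
    \<open>e\<close>.\<close>
  have "e \<cdot> (c' \<cdot> f) = e \<cdot> Zero C a r"
    using comp_assoc[OF e c' f] ec' cf comp_Zero[OF e aO] by simp
  then have "c' \<cdot> f = Zero C a r"
    using e_mono[OF a comp_in_Hom[OF c' f] Zero_in_Hom[OF aO rO]] by blast
  then obtain d where d: "d \<in> Hom C t r" and dc: "d \<cdot> c = c'"
    using c_factor[OF c'] by blast
  have "e \<cdot> d \<cdot> c = Id C t \<cdot> c"
    using comp_assoc[OF e d c] dc ec' comp_id_left[OF c] by simp
  then have ed: "e \<cdot> d = Id C t"
    using c_epi[OF comp_in_Hom[OF e d] id_in_Hom[OF tO]] by blast
  \<comment> \<open>The section \<open>d\<close> of \<open>e\<close> is also a left inverse:
    \<open>e\<close> is cancelled on morphisms out of \<open>r\<close>.\<close>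
  have "e \<cdot> (d \<cdot> e) = e \<cdot> Id C r"
    using comp_assoc[OF e d e] ed comp_id_left[OF e] comp_id_right[OF e] by simp
  then have "d \<cdot> e = Id C r"
    using e_mono[OF r comp_in_Hom[OF d e] id_in_Hom[OF rO]] by blast
  then have "isomorphic_objs C r t"
    using rO tO e d ed unfolding isomorphic_objs_def by blast
  then show "Cod C c \<in> B" using iso r unfolding t_def by blast
qed

text \<open>Existence of kernels and cokernels enters as hypotheses on a preadditive category. The
  result can thus be applied to \<open>op_cat A\<close> once that is known to be preadditive, with
  the two hypotheses exchanged by duality.\<close>

theorem coreflective_iff:
  assumes B: "B \<subseteq> Obj C"
    and iso: "\<And>a b. a \<in> B \<Longrightarrow> isomorphic_objs C a b \<Longrightarrow> b \<in> B"
    and ker: "\<And>f. f \<in> Arr C \<Longrightarrow> \<exists>k. is_kernel C f k"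
    and coker: "\<And>f. f \<in> Arr C \<Longrightarrow> \<exists>c. is_cokernel C f c"
  shows "coreflective C B \<longleftrightarrow> precovering C B \<and> closed_under_cokernels C B"
proof
  assume "coreflective C B"
  then have ex: "\<exists>b e. is_coreflection C B a b e" if "a \<in> Obj C" for a
    using that coreflective_iff_coreflection[OF B] by blast
  then have "precovering C B"
    using is_coreflection_imp_precover[of C B] unfolding precovering_def by metis
  moreover have "closed_under_cokernels C B"
    by (rule closed_under_cokernels_if_coreflections[OF B _ ex]) (use iso in blast)
  ultimately show "precovering C B \<and> closed_under_cokernels C B" by blast
next
  assume "precovering C B \<and> closed_under_cokernels C B"
  then show "coreflective C B"
    using coreflection_of_precover[OF B _ _ ker coker]
    by (intro coreflection_imp_coreflective[OF B]) simp_all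
qed

end

section \<open>The opposite category\<close>

text \<open>Objects, morphisms, identities and sums are kept, while \<open>Zero\<close> swaps its
  objects to follow the reversed sets of morphisms. As a record update on the same type it is a
  literal involution, and an inclusion functor keeps its form.\<close>

definition op_cat ::
  "('o, 'm, 'x) preadditive_category_scheme \<Rightarrow> ('o, 'm, 'x) preadditive_category_scheme" where
  "op_cat C = C\<lparr>Dom := Cod C, Cod := Dom C, Comp := (\<lambda>g f. f \<cdot>\<^bsub>C\<^esub> g),
    Zero := (\<lambda>a b. Zero C b a)\<rparr>"

lemma op_cat_simps [simp]:
  "Obj (op_cat C) = Obj C" "Arr (op_cat C) = Arr C" "Dom (op_cat C) = Cod C"
  "Cod (op_cat C) = Dom C" "Id (op_cat C) = Id C" "g \<cdot>\<^bsub>op_cat C\<^esub> f = f \<cdot>\<^bsub>C\<^esub> g"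
  "Plus (op_cat C) = Plus C" "Zero (op_cat C) a b = Zero C b a"
  by (simp_all add: op_cat_def)

lemma Hom_op_cat [simp]: "Hom (op_cat C) a b = Hom C b a"
  by (auto simp: Hom_def)

lemma op_cat_op_cat [simp]: "op_cat (op_cat C) = C"
  by (simp add: op_cat_def)

lemma full_subcategory_op_cat:
  "full_subcategory (op_cat C) B = op_cat (full_subcategory C B)"
  by (auto simp: full_subcategory_def op_cat_def conj_commute)

text \<open>Associativity in the orientation that the associativity law of \<open>op_cat C\<close>
  takes once its compositions are unfolded.\<close>

lemma (in category) comp_assoc3:
  assumes "f \<in> Hom C a b" "g \<in> Hom C b c" "h \<in> Hom C c d"
  shows "h \<cdot> (g \<cdot> f) = (h \<cdot> g) \<cdot> f"
  using comp_assoc assms by simp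

lemma category_op_cat:
  assumes "category C"
  shows "category (op_cat C)"
proof -
  interpret category C by (rule assms)
  show ?thesis
    by unfold_locales
      (auto intro: dom_in_Obj cod_in_Obj id_in_Hom comp_in_Hom comp_id_left comp_id_right
        comp_assoc3)
qed

text \<open>The group from \<open>a\<close> to \<open>b\<close> is the old group from
  \<open>b\<close> to \<open>a\<close>, and the two distributive laws exchange roles.\<close>

lemma preadditive_category_op_cat:
  assumes "preadditive_category C"
  shows "preadditive_category (op_cat C)"
proof -
  interpret preadditive_category C by (rule assms)
  have Hom_group: "Hom_group (op_cat C) a b = Hom_group C b a" for a b
    by (simp add: Hom_group_def)
  show ?thesis
    by (intro preadditive_category.intro category_op_cat category_axioms
        preadditive_category_axioms.intro)
      (auto simp: Hom_group intro: Hom_comm_group comp_plus_left comp_plus_right)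
qed

lemma cat_functor_op_cat:
  assumes "cat_functor C D F"
  shows "cat_functor (op_cat C) (op_cat D) F"
proof -
  interpret cat_functor C D F by (rule assms)
  show ?thesis
    by (intro cat_functor.intro category_op_cat source.category_axioms target.category_axioms
        cat_functor_axioms.intro)
      (auto intro: map_Obj map_Hom map_Id map_Comp)
qed

text \<open>Reversing arrows exchanges left and right adjoints. A bijection from
  \<open>D(F a, b)\<close> to \<open>C(a, G b)\<close> has to be read backwards, so the new
  adjunction is given by the inverses of \<phi>.\<close>

lemma adjoint_functors_op_cat:
  assumes "adjoint_functors C D F G"
  shows "adjoint_functors (op_cat D) (op_cat C) G F"
proof -
  obtain \<phi> where F: "cat_functor C D F" and G: "cat_functor D C G"
    and bij: "\<And>a b. a \<in> Obj C \<Longrightarrow> b \<in> Obj D \<Longrightarrow>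
        bij_betw (\<phi> a b) (Hom D (ObjMap F a) b) (Hom C a (ObjMap G b))"
    and nat: "\<And>a a' b b' f g h. \<lbrakk>a \<in> Obj C; a' \<in> Obj C; b \<in> Obj D; b' \<in> Obj D;
        f \<in> Hom C a' a; g \<in> Hom D b b'; h \<in> Hom D (ObjMap F a) b\<rbrakk> \<Longrightarrow>
      \<phi> a' b' (g \<cdot>\<^bsub>D\<^esub> h \<cdot>\<^bsub>D\<^esub> ArrMap F f) = ArrMap G g \<cdot>\<^bsub>C\<^esub> \<phi> a b h \<cdot>\<^bsub>C\<^esub> f"
    by (rule adjoint_functorsE[OF assms]) blast
  interpret F: cat_functor C D F by (rule F)
  interpret G: cat_functor D C G by (rule G)
  define \<psi> where "\<psi> = (\<lambda>b a. the_inv_into (Hom D (ObjMap F a) b) (\<phi> a b))"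
  have \<psi>_bij: "bij_betw (\<psi> b a) (Hom C a (ObjMap G b)) (Hom D (ObjMap F a) b)"
    if "a \<in> Obj C" "b \<in> Obj D" for a b
    unfolding \<psi>_def by (rule bij_betw_the_inv_into[OF bij[OF that]])
  have \<phi>\<psi>: "\<phi> a b (\<psi> b a h) = h"
    if "a \<in> Obj C" "b \<in> Obj D" "h \<in> Hom C a (ObjMap G b)" for a b h
    unfolding \<psi>_def by (rule f_the_inv_into_f_bij_betw[OF bij[OF that(1,2)]]) (use that in simp)
  \<comment> \<open>The right-nested bracketing is the form taken by the left-nested composites of
    the naturality condition in the opposite categories.\<close>
  have \<psi>_natural: "\<psi> b' a' (ArrMap G f \<cdot>\<^bsub>C\<^esub> (h \<cdot>\<^bsub>C\<^esub> g)) = f \<cdot>\<^bsub>D\<^esub> (\<psi> b a h \<cdot>\<^bsub>D\<^esub> ArrMap F g)"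
    if ob: "a \<in> Obj C" "a' \<in> Obj C" "b \<in> Obj D" "b' \<in> Obj D"
      and g: "g \<in> Hom C a' a" and f: "f \<in> Hom D b b'" and h: "h \<in> Hom C a (ObjMap G b)"
    for a a' b b' f g h
  proof -
    have k: "\<psi> b a h \<in> Hom D (ObjMap F a) b"
      using \<psi>_bij[OF ob(1,3)] h by (auto simp: bij_betw_def)
    have k': "f \<cdot>\<^bsub>D\<^esub> \<psi> b a h \<cdot>\<^bsub>D\<^esub> ArrMap F g \<in> Hom D (ObjMap F a') b'"
      by (intro F.target.comp_in_Hom[OF _ F.map_Hom[OF g]] F.target.comp_in_Hom[OF f k])
    have "\<phi> a' b' (f \<cdot>\<^bsub>D\<^esub> \<psi> b a h \<cdot>\<^bsub>D\<^esub> ArrMap F g) = ArrMap G f \<cdot>\<^bsub>C\<^esub> h \<cdot>\<^bsub>C\<^esub> g"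
      using nat[OF ob g f k] \<phi>\<psi>[OF ob(1,3) h] by simp
    also have "\<dots> = ArrMap G f \<cdot>\<^bsub>C\<^esub> (h \<cdot>\<^bsub>C\<^esub> g)"
      by (rule F.source.comp_assoc[OF G.map_Hom[OF f] h g])
    finally have "\<psi> b' a' (ArrMap G f \<cdot>\<^bsub>C\<^esub> (h \<cdot>\<^bsub>C\<^esub> g)) = f \<cdot>\<^bsub>D\<^esub> \<psi> b a h \<cdot>\<^bsub>D\<^esub> ArrMap F g"
      using the_inv_into_f_f[OF bij_betw_imp_inj_on[OF bij[OF ob(2,4)]] k'] by (simp add: \<psi>_def)
    then show ?thesis
      using F.target.comp_assoc[OF f k F.map_Hom[OF g]] by simp
  qed
  show ?thesis
    unfolding adjoint_functors_def
    by (intro conjI cat_functor_op_cat F G exI[of _ \<psi>])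
      (use \<psi>_bij \<psi>_natural in simp_all)
qed

section \<open>Dualising the notions for subcategories\<close>

lemma reflective_op_cat: "reflective A B \<longleftrightarrow> coreflective (op_cat A) B"
proof
  assume "reflective A B"
  then show "coreflective (op_cat A) B"
    \<comment> \<open>The same functor serves as left adjoint before and right adjoint after
      reversal, since opposites commute with full subcategories.\<close>
    using adjoint_functors_op_cat unfolding reflective_def coreflective_def full_subcategory_op_cat
    by blast
next
  assume "coreflective (op_cat A) B"
  then obtain L where "adjoint_functors (op_cat (full_subcategory A B)) (op_cat A) inclusion_functor L"
    unfolding coreflective_def full_subcategory_op_cat by blast
  \<comment> \<open>A second reversal returns to \<open>A\<close> itself by
    \<open>op_cat_op_cat\<close>.\<close>
  from adjoint_functors_op_cat[OF this] show "reflective A B"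
    unfolding reflective_def by auto
qed

lemma preenveloping_op_cat: "preenveloping A B \<longleftrightarrow> precovering (op_cat A) B"
  by (simp add: preenveloping_def precovering_def is_preenvelope_def is_precover_def)

lemma is_kernel_op_cat: "is_kernel (op_cat C) f c \<longleftrightarrow> is_cokernel C f c"
  by (simp add: is_kernel_def is_cokernel_def)

lemma is_cokernel_op_cat: "is_cokernel (op_cat C) f k \<longleftrightarrow> is_kernel C f k"
  by (simp add: is_kernel_def is_cokernel_def)

lemma closed_under_kernels_op_cat:
  "closed_under_kernels A B \<longleftrightarrow> closed_under_cokernels (op_cat A) B"
  by (auto simp: closed_under_kernels_def closed_under_cokernels_def is_cokernel_op_cat)

lemma isomorphic_objs_op_cat: "isomorphic_objs (op_cat C) a b \<longleftrightarrow> isomorphic_objs C a b"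
  by (auto simp: isomorphic_objs_def)

theorem corollary7p2:
  fixes A :: "('o, 'm, 'x) preadditive_category_scheme" and B :: "'o set"
  assumes "preabelian_category A"
    and "additive_subcategory A B"
  shows "(coreflective A B \<longleftrightarrow> precovering A B \<and> closed_under_cokernels A B) \<and>
    (reflective A B \<longleftrightarrow> preenveloping A B \<and> closed_under_kernels A B)"
proof
  interpret preabelian_category A by (rule assms(1))
  interpret op: preadditive_category "op_cat A"
    by (rule preadditive_category_op_cat[OF preadditive_category_axioms])
  have B: "B \<subseteq> Obj A" and iso: "\<And>a b. a \<in> B \<Longrightarrow> isomorphic_objs A a b \<Longrightarrow> b \<in> B"
    using assms(2) unfolding additive_subcategory_def by blast+
  show "coreflective A B \<longleftrightarrow> precovering A B \<and> closed_under_cokernels A B"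
    by (rule coreflective_iff[OF B iso ex_kernel ex_cokernel])
  \<comment> \<open>Kernels in \<open>op_cat A\<close> are the cokernels of \<open>A\<close> and
    conversely, so \<open>ex_cokernel\<close> and \<open>ex_kernel\<close> supply the two existence
    hypotheses in exchanged roles.\<close>
  have "coreflective (op_cat A) B \<longleftrightarrow>
      precovering (op_cat A) B \<and> closed_under_cokernels (op_cat A) B"
    by (rule op.coreflective_iff)
      (use B iso ex_kernel ex_cokernel in
        \<open>auto simp: isomorphic_objs_op_cat is_kernel_op_cat is_cokernel_op_cat\<close>)
  then show "reflective A B \<longleftrightarrow> preenveloping A B \<and> closed_under_kernels A B"
    by (simp add: reflective_op_cat preenveloping_op_cat closed_under_kernels_op_cat)
qed

end
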